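(* Let $e_1,e_2,\dots$ be a sequence with $e_i\in\{-1,1\}$, let ${\bf e}(n)=(e_n,\dots,e_2,e_1,e_1,e_2,\dots,e_n)$, let $\bigtriangleup_n(t)$ be the Alexander polynomial of the kmot group $G({\bf e}(n))$ for $n\ge1$, and $\bigtriangleup_0(t)=1$. Let $\delta_n=e_{n-1}e_n$ and $\alpha_n(t)=\frac{\delta_n+1}{2}(t+t^{-1})$. Then for all $n>2$, $$\bigtriangleup_n(t)+\bigtriangleup_{n-1}(t)=\alpha_n(t)\bigl(\bigtriangleup_{n-1}(t)+\bigtriangleup_{n-2}(t)\bigr)-\delta_n\bigl(\bigtriangleup_{n-2}(t)+\bigtriangleup_{n-3}(t)\bigr).$$
   Context: For a symmetric sign sequence $\epsilon=(\epsilon_1,\dots,\epsilon_{2n})$ (i.e. $\epsilon_i=\epsilon_{2n+1-i}\in\{1,-1\}$) the kmot group is $G(\epsilon)=\langle x,y\mid wx=yw\rangle$ with $w=x^{\epsilon_1}y^{\epsilon_2}x^{\epsilon_3}y^{\epsilon_4}\cdots x^{\epsilon_{2n-1}}y^{\epsilon_{2n}}$. Its abelianization is infinite cyclic, generated by $t$, the common image of $x$ and $y$. Its Alexander polynomial is the generator in $\mathbb{Z}[t,t^{-1}]$ of the first elementary ideal (the ideal generated by the images of the Fox derivatives of the relator), normalized so that $\bigtriangleup(t)=\bigtriangleup(t^{-1})$ and $\bigtriangleup(1)=1$. *)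

theory Defs
  imports Complex_Main "HOL-Library.Poly_Mapping"
begin

section \<open>Free groups\<close>

text \<open>The letter \<open>(i, True)\<close> stands for the generator \<open>i\<close> and \<open>(i, False)\<close> for its inverse. Free
  groups are written additively, because the product that \<^theory>\<open>HOL-Library.Poly_Mapping\<close> puts on
  finitely supported functions is the convolution with respect to \<open>+\<close>: with \<open>'a free_group\<close> in class
  \<^class>\<open>group_add\<close> (which does not assume commutativity), the ring \<open>'a free_group \<Rightarrow>\<^sub>0 int\<close> is the
  integral group ring, and \<open>int \<Rightarrow>\<^sub>0 int\<close> is the ring of Laurent polynomials in
  \<open>t = frag_of 1\<close> over the integers.\<close>

inductive cancel :: "('a \<times> bool) list \<Rightarrow> ('a \<times> bool) list \<Rightarrow> bool" where
  "cancel (u @ (i, b) # (i, \<not> b) # v) (u @ v)"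

quotient_type 'a free_group = "('a \<times> bool) list" / "equivclp cancel"
  by (intro equivpI) simp_all

lemma equivclp_map:
  assumes "equivclp r u v" "\<And>u v. r u v \<Longrightarrow> equivclp s (f u) (f v)"
  shows "equivclp s (f u) (f v)"
  using assms(1)
proof (induction rule: equivclp_induct)
  case base
  show ?case by (rule equivclp_refl)
next
  case (step y z)
  have "equivclp s (f y) (f z)"
    using step.hyps(2) assms(2) equivclp_sym by metis
  with step.IH show ?case by (rule equivclp_trans)
qed

lemma equivclp_invariant:
  assumes "equivclp r u v" "\<And>u v. r u v \<Longrightarrow> f u = f v"
  shows "f u = f v"
  using assms(1) by (induction rule: equivclp_induct) (use assms(2) in metis)+

definition inverse_word :: "('a \<times> bool) list \<Rightarrow> ('a \<times> bool) list" where
  "inverse_word w = rev (map (\<lambda>(i, b). (i, \<not> b)) w)"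

lemma cancel_append1: "cancel u v \<Longrightarrow> cancel (u @ w) (v @ w)"
  by (auto elim!: cancel.cases intro: cancel.intros simp flip: append_Cons)
     (metis append_Cons append_assoc cancel.intros)

lemma cancel_append2: "cancel u v \<Longrightarrow> cancel (w @ u) (w @ v)"
  by (elim cancel.cases) (metis append_assoc cancel.intros)

lemma cancel_inverse_word: "cancel u v \<Longrightarrow> cancel (inverse_word u) (inverse_word v)"
proof (elim cancel.cases)
  fix p i b q
  assume [simp]: "u = p @ (i, b) # (i, \<not> b) # q" "v = p @ q"
  show ?thesis
    using cancel.intros[of "inverse_word q" i b "inverse_word p"]
    by (simp add: inverse_word_def)
qed

lemma inverse_word_append_self: "equivclp cancel (inverse_word w @ w) []"
proof (induction w)
  case Nil
  show ?case by (simp add: inverse_word_def equivclp_refl)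
next
  case (Cons l w)
  obtain i b where l: "l = (i, b)" by fastforce
  have "cancel (inverse_word (l # w) @ l # w) (inverse_word w @ w)"
    using cancel.intros[of "inverse_word w" i "\<not> b" w] by (simp add: inverse_word_def l)
  with Cons.IH show ?case
    by (meson equivclp_trans r_into_equivclp)
qed

instantiation free_group :: (type) group_add
begin

lift_definition zero_free_group :: "'a free_group" is "[]" .

lift_definition plus_free_group :: "'a free_group \<Rightarrow> 'a free_group \<Rightarrow> 'a free_group" is "(@)"
proof -
  fix u u' v v' :: "('a \<times> bool) list"
  assume "equivclp cancel u u'" "equivclp cancel v v'"
  then have "equivclp cancel (u @ v) (u' @ v)" "equivclp cancel (u' @ v) (u' @ v')"
    by (auto elim!: equivclp_map intro: cancel_append1 cancel_append2 r_into_equivclp)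
  then show "equivclp cancel (u @ v) (u' @ v')" by (rule equivclp_trans)
qed

lift_definition uminus_free_group :: "'a free_group \<Rightarrow> 'a free_group" is inverse_word
  by (erule equivclp_map) (blast intro: cancel_inverse_word r_into_equivclp)

definition minus_free_group :: "'a free_group \<Rightarrow> 'a free_group \<Rightarrow> 'a free_group" where
  "minus_free_group g h = g + - h"

instance
proof
  fix a b c :: "'a free_group"
  show "a + b + c = a + (b + c)" by transfer (simp add: equivclp_refl)
  show "0 + a = a" by transfer (simp add: equivclp_refl)
  show "a + 0 = a" by transfer (simp add: equivclp_refl)
  show "- a + a = 0" by transfer (rule inverse_word_append_self)
  show "a + - b = a - b" by (simp add: minus_free_group_def)
qed

end

lift_definition letter :: "'a \<Rightarrow> bool \<Rightarrow> 'a free_group" is "\<lambda>i b. [(i, b)]" .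

definition gen :: "'a \<Rightarrow> 'a free_group" where
  "gen i = letter i True"

lemma letter_eq: "letter i b = (if b then gen i else - gen i)"
proof -
  have "letter i False = - gen i"
    unfolding gen_def by transfer (simp add: inverse_word_def equivclp_refl)
  then show ?thesis by (cases b) (simp_all add: gen_def)
qed

lemma free_group_induct [case_names zero gen uminus_gen]:
  assumes "P 0" "\<And>i g. P g \<Longrightarrow> P (gen i + g)" "\<And>i g. P g \<Longrightarrow> P (- gen i + g)"
  shows "P g"
proof -
  obtain w where w: "g = abs_free_group w"
    by (induction g rule: free_group.abs_induct) blast
  have "P (abs_free_group w)"
  proof (induction w)
    case Nil
    then show ?case using assms(1) by (simp add: zero_free_group.abs_eq)
  next
    case (Cons l w)
    obtain i b where l: "l = (i, b)" by fastforce
    have "abs_free_group (l # w) = letter i b + abs_free_group w"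
      by (simp add: l letter.abs_eq plus_free_group.abs_eq)
    then show ?case using assms(2,3) Cons.IH by (simp add: letter_eq)
  qed
  then show ?thesis by (simp add: w)
qed

section \<open>Fox derivatives\<close>

fun fox_word :: "'a \<Rightarrow> ('a \<times> bool) list \<Rightarrow> ('a free_group \<Rightarrow>\<^sub>0 int)" where
  "fox_word j [] = 0"
| "fox_word j ((i, b) # w) =
     (if i = j then if b then 1 else - frag_of (- gen i) else 0) + frag_of (letter i b) * fox_word j w"

lemma frag_of_add:
  fixes g h :: "'a :: monoid_add"
  shows "frag_of (g + h) = frag_of g * frag_of h"
  by (simp add: mult_single)

lemma frag_of_zero: "frag_of (0 :: 'a :: monoid_add) = 1"
  by (simp flip: single_one)

lemma fox_word_append:
  "fox_word j (u @ v) = fox_word j u + frag_of (abs_free_group u) * fox_word j v"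
proof (induction u)
  case Nil
  show ?case by (simp flip: zero_free_group.abs_eq add: frag_of_zero)
next
  case (Cons l u)
  obtain i b where l: "l = (i, b)" by fastforce
  have "abs_free_group (l # u) = letter i b + abs_free_group u"
    by (simp add: l letter.abs_eq plus_free_group.abs_eq)
  then show ?case using Cons.IH
    by (simp add: l frag_of_add distrib_left mult.assoc add.assoc)
qed

lemma fox_word_cancel: "cancel u v \<Longrightarrow> fox_word j u = fox_word j v"
proof (elim cancel.cases)
  fix p i b q
  assume uv: "u = p @ (i, b) # (i, \<not> b) # q" "v = p @ q"
  have "frag_of (gen i) * (frag_of (- gen i) * x) = x"
       "frag_of (- gen i) * (frag_of (gen i) * x) = x" for x :: "'a free_group \<Rightarrow>\<^sub>0 int"
    by (simp_all add: frag_of_zero flip: frag_of_add mult.assoc)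
  moreover have "frag_of (gen i) * frag_of (- gen i) = (1 :: 'a free_group \<Rightarrow>\<^sub>0 int)"
    by (simp add: frag_of_zero flip: frag_of_add)
  ultimately show ?thesis
    by (cases b; cases "j = i") (simp_all add: uv fox_word_append letter_eq distrib_left right_diff_distrib flip: add.assoc)
qed

lift_definition fox :: "'a \<Rightarrow> 'a free_group \<Rightarrow> ('a free_group \<Rightarrow>\<^sub>0 int)" is fox_word
  by (erule equivclp_invariant) (rule fox_word_cancel)

text \<open>The two rules that determine the Fox derivatives:\<close>

lemma fox_gen: "fox j (gen i) = (if i = j then 1 else 0)"
  by (simp add: gen_def letter.abs_eq fox.abs_eq)

lemma fox_add: "fox j (g + h) = fox j g + frag_of g * fox j h"
  by (induction g rule: free_group.abs_induct; induction h rule: free_group.abs_induct)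
     (simp add: plus_free_group.abs_eq fox.abs_eq fox_word_append)

section \<open>Alexander polynomials\<close>

fun exponent_sum_word :: "('a \<times> bool) list \<Rightarrow> int" where
  "exponent_sum_word [] = 0"
| "exponent_sum_word ((i, b) # w) = (if b then 1 else - 1) + exponent_sum_word w"

lemma exponent_sum_word_append:
  "exponent_sum_word (u @ v) = exponent_sum_word u + exponent_sum_word v"
  by (induction u rule: exponent_sum_word.induct) simp_all

lift_definition exponent_sum :: "'a free_group \<Rightarrow> int" is exponent_sum_word
  by (erule equivclp_invariant) (auto elim!: cancel.cases simp: exponent_sum_word_append)

lemma exponent_sum_gen: "exponent_sum (gen i) = 1"
  by (simp add: gen_def letter.abs_eq exponent_sum.abs_eq)

lemma exponent_sum_add: "exponent_sum (g + h) = exponent_sum g + exponent_sum h"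
  by transfer (rule exponent_sum_word_append)

text \<open>The linear extension to group rings of a map between groups.\<close>

definition group_ring_map :: "('a \<Rightarrow> 'b) \<Rightarrow> ('a \<Rightarrow>\<^sub>0 int) \<Rightarrow> ('b \<Rightarrow>\<^sub>0 int)" where
  "group_ring_map f = frag_extend (\<lambda>g. frag_of (f g))"

datatype kmot_gen = GenX | GenY

text \<open>The first elementary ideal of the presentation with generators \<open>GenX\<close>, \<open>GenY\<close> and the single
  relator \<open>r\<close>, when the abelianization is infinite cyclic, generated by the common image \<open>t\<close> of the
  generators. The map \<open>exponent_sum\<close> is then the projection of the free group onto the
  abelianization, written as the additive group of integers. With the multiplication as scaling,
  \<^const>\<open>module.span\<close> gives the ideal generated by a set.\<close>

definition elementary_ideal :: "kmot_gen free_group \<Rightarrow> (int \<Rightarrow>\<^sub>0 int) set" where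
  "elementary_ideal r =
     module.span (*) {group_ring_map exponent_sum (fox GenX r), group_ring_map exponent_sum (fox GenY r)}"

text \<open>The substitution of the inverse of \<open>t\<close> for \<open>t\<close>, and of \<open>1\<close> for \<open>t\<close>.\<close>

definition laurent_reflect :: "(int \<Rightarrow>\<^sub>0 int) \<Rightarrow> (int \<Rightarrow>\<^sub>0 int)" where
  "laurent_reflect = group_ring_map uminus"

definition laurent_at_one :: "(int \<Rightarrow>\<^sub>0 int) \<Rightarrow> int" where
  "laurent_at_one d = (\<Sum>k\<in>Poly_Mapping.keys d. Poly_Mapping.lookup d k)"

text \<open>The units of the Laurent polynomial ring are \<open>\<plusminus> t\<^sup>k\<close>, so the symmetry and the value
  at \<open>1\<close> leave at most one generator.\<close>

definition alexander_polynomial :: "kmot_gen free_group \<Rightarrow> (int \<Rightarrow>\<^sub>0 int)" where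
  "alexander_polynomial r =
     (THE d. module.span (*) {d} = elementary_ideal r \<and> laurent_reflect d = d \<and> laurent_at_one d = 1)"

section \<open>Kmot groups\<close>

definition symmetric_sign_sequence :: "int list \<Rightarrow> bool" where
  "symmetric_sign_sequence es \<longleftrightarrow> even (length es) \<and> set es \<subseteq> {1, - 1} \<and> rev es = es"

definition sign_power :: "'a :: group_add \<Rightarrow> int \<Rightarrow> 'a" where
  "sign_power g s = (if s = 1 then g else - g)"

text \<open>List positions start at \<open>0\<close>, so \<open>GenX\<close> belongs to the even ones.\<close>

definition kmot_word :: "int list \<Rightarrow> kmot_gen free_group" where
  "kmot_word es =
     (\<Sum>i\<leftarrow>[0..<length es]. sign_power (gen (if even i then GenX else GenY)) (es ! i))"

text \<open>The relation \<open>wx = yw\<close> as the relator \<open>w x w\<inverse> y\<inverse>\<close>. The kmot group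
  enters through this presentation.\<close>

definition kmot_relator :: "int list \<Rightarrow> kmot_gen free_group" where
  "kmot_relator es = kmot_word es + gen GenX - kmot_word es - gen GenY"

text \<open>A homomorphism from the free group to an abelian group factors through the kmot group iff it
  factors through \<open>exponent_sum\<close>; so \<open>exponent_sum\<close> is the abelianization of the kmot group.\<close>

lemma kmot_abelianization:
  fixes f :: "kmot_gen free_group \<Rightarrow> 'b :: ab_group_add"
  assumes "\<And>g h. f (g + h) = f g + f h"
  shows "f (kmot_relator es) = 0 \<longleftrightarrow> (\<forall>g h. exponent_sum g = exponent_sum h \<longrightarrow> f g = f h)"
proof -
  have f0: "f 0 = 0" using assms[of 0 0] by simp
  have fu: "f (- g) = - f g" for g
    using assms[of "- g" g] f0 by (simp add: eq_neg_iff_add_eq_0)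
  have fm: "f (g - h) = f g - f h" for g h
    by (metis add_uminus_conv_diff assms fu)
  have r: "f (kmot_relator es) = f (gen GenX) - f (gen GenY)"
    by (simp add: kmot_relator_def fm assms)
  have e0: "exponent_sum (0 :: kmot_gen free_group) = 0"
    using exponent_sum_add[of 0 "0 :: kmot_gen free_group"] by simp
  have eu: "exponent_sum (- g) = - exponent_sum g" for g :: "kmot_gen free_group"
    using exponent_sum_add[of "- g" g] e0 by simp
  define m :: "int \<Rightarrow> 'b" where
    "m k = (if k \<ge> 0 then (\<Sum>i<nat k. f (gen GenX)) else - (\<Sum>i<nat (- k). f (gen GenX)))" for k
  have m1: "m (k + 1) = m k + f (gen GenX)" for k
  proof (cases "k \<ge> 0")
    case True
    then show ?thesis by (simp add: m_def nat_add_distrib)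
  next
    case False
    then have "nat (- k) = Suc (nat (- (k + 1)))" by simp
    then show ?thesis using False by (auto simp: m_def)
  qed
  have m2: "m (k - 1) = m k - f (gen GenX)" for k
    using m1[of "k - 1"] by simp
  have *: "f g = m (exponent_sum g)" if eq: "f (gen GenX) = f (gen GenY)" for g
  proof -
    define c where "c = f (gen GenX)"
    have fg: "f (gen i) = c" for i by (cases i) (simp_all add: eq c_def)
    show ?thesis
    proof (induction g rule: free_group_induct)
      case zero
      show ?case by (simp add: f0 e0 m_def)
    next
      case (gen i g)
      then show ?case
        using m1[of "exponent_sum g"]
        by (simp add: assms exponent_sum_add exponent_sum_gen fg add.commute)
    next
      case (uminus_gen i g)
      then show ?case
        using m2[of "exponent_sum g"]
        by (simp add: assms exponent_sum_add exponent_sum_gen fg fu eu add.commute)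
    qed
  qed
  show ?thesis
    using r * exponent_sum_gen by (metis eq_iff_diff_eq_0)
qed

text \<open>The sequence \<open>(e n, \<dots>, e 2, e 1, e 1, e 2, \<dots>, e n)\<close>.\<close>

definition palindrome :: "(nat \<Rightarrow> int) \<Rightarrow> nat \<Rightarrow> int list" where
  "palindrome e n = rev (map e [1..<n + 1]) @ map e [1..<n + 1]"

lemma symmetric_sign_sequence_palindrome:
  assumes "\<And>i. i \<ge> 1 \<Longrightarrow> e i \<in> {- 1, 1}"
  shows "symmetric_sign_sequence (palindrome e n)"
  using assms by (auto simp: symmetric_sign_sequence_def palindrome_def rev_map)

definition kmot_alexander :: "(nat \<Rightarrow> int) \<Rightarrow> nat \<Rightarrow> (int \<Rightarrow>\<^sub>0 int)" where
  "kmot_alexander e n = (if n = 0 then 1 else alexander_polynomial (kmot_relator (palindrome e n)))"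

end

theory Submission
  imports Defs
begin

text \<open>Let \<open>p\<^sub>i\<close> be the partial sums of a sign sequence of even length. The first elementary ideal is
  generated by \<open>1 + (t - 1) d\<close>, where \<open>d\<close> is the abelianized Fox derivative of \<open>w\<close> with respect to
  \<open>y\<close>. A letter \<open>y\<^bsup>\<plusminus>1\<^esup>\<close> of \<open>w\<close> contributes \<open>t\<^bsup>p\<^sub>i\<^esup> - t\<^bsup>p\<^sub>i\<^sub>-\<^sub>1\<^esup>\<close> to \<open>(t - 1) d\<close>, whatever its sign, so the
  generator is the alternating sum of the \<open>t\<^bsup>p\<^sub>i\<^esup>\<close>. Centred at the middle of the palindrome it becomes
  the Alexander polynomial, and with \<open>q\<^sub>n = e\<^sub>1 + \<dots> + e\<^sub>n\<close> consecutive polynomials satisfy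
  \<open>\<Delta>\<^sub>n + \<Delta>\<^sub>n\<^sub>-\<^sub>1 = t\<^bsup>q\<^sub>n\<^esup> + t\<^bsup>-q\<^sub>n\<^esup>\<close>. The recurrence is then the product formula for these sums when
  \<open>\<delta>\<^sub>n = 1\<close>, and it is \<open>q\<^sub>n = q\<^sub>n\<^sub>-\<^sub>2\<close> when \<open>\<delta>\<^sub>n = -1\<close>.

  For the uniqueness of the normalized generator: two symmetric associates differ by a symmetric unit,
  and a symmetric Laurent polynomial has nonnegative degree, so this unit and its inverse are constant.\<close>

section \<open>Laurent polynomials\<close>

lemma group_ring_map_frag_of [simp]: "group_ring_map f (frag_of g) = frag_of (f g)"
  by (simp add: group_ring_map_def)

lemma group_ring_map_0 [simp]: "group_ring_map f 0 = 0"
  by (simp add: group_ring_map_def)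

lemma group_ring_map_diff: "group_ring_map f (a - b) = group_ring_map f a - group_ring_map f b"
  by (simp add: group_ring_map_def frag_extend_diff)

lemma group_ring_map_add: "group_ring_map f (a + b) = group_ring_map f a + group_ring_map f b"
  by (simp add: group_ring_map_def frag_extend_add)

text \<open>Both sides are additive in \<open>a\<close> and in \<open>b\<close>, so
  \<open>frag_induction\<close> in each factor reduces the claim to basis elements.\<close>

lemma group_ring_map_mult:
  fixes f :: "'a :: monoid_add \<Rightarrow> 'b :: monoid_add"
  assumes f: "\<And>g h. f (g + h) = f g + f h"
  shows "group_ring_map f (a * b) = group_ring_map f a * group_ring_map f b"
proof -
  have left: "group_ring_map f (frag_of g * b) = frag_of (f g) * group_ring_map f b" for g
    using subset_UNIV[of "Poly_Mapping.keys b"]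
  proof (induction b rule: frag_induction)
    case (one h)
    show ?case by (simp add: f flip: frag_of_add)
  qed (simp_all add: group_ring_map_diff right_diff_distrib)
  show ?thesis
    using subset_UNIV[of "Poly_Mapping.keys a"]
    by (induction a rule: frag_induction)
       (simp_all add: left group_ring_map_diff left_diff_distrib)
qed

lemma lookup_laurent_reflect:
  "Poly_Mapping.lookup (laurent_reflect d) k = Poly_Mapping.lookup d (- k)"
  using subset_UNIV[of "Poly_Mapping.keys d"]
  by (induction d rule: frag_induction)
     (auto simp: laurent_reflect_def group_ring_map_diff lookup_minus lookup_single when_def)

lemma laurent_reflect_mult: "laurent_reflect (a * b) = laurent_reflect a * laurent_reflect b"
  by (simp add: laurent_reflect_def group_ring_map_mult)

lemma laurent_at_one_superset:
  assumes "finite K" "Poly_Mapping.keys d \<subseteq> K"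
  shows "laurent_at_one d = (\<Sum>k\<in>K. Poly_Mapping.lookup d k)"
  unfolding laurent_at_one_def using assms
  by (intro sum.mono_neutral_left) (auto simp: in_keys_iff)

lemma laurent_at_one_diff: "laurent_at_one (a - b) = laurent_at_one a - laurent_at_one b"
proof -
  define K where "K = Poly_Mapping.keys a \<union> Poly_Mapping.keys b"
  have "Poly_Mapping.keys (a - b) \<subseteq> K"
    by (auto simp: K_def in_keys_iff lookup_minus)
  then show ?thesis
    using laurent_at_one_superset[of K "a - b"] laurent_at_one_superset[of K a]
      laurent_at_one_superset[of K b]
    by (simp add: K_def lookup_minus sum_subtractf)
qed

lemma laurent_at_one_frag_of [simp]: "laurent_at_one (frag_of k) = 1"
  by (simp add: laurent_at_one_def)

lemma laurent_at_one_0 [simp]: "laurent_at_one 0 = 0"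
  by (simp add: laurent_at_one_def)

lemma laurent_at_one_uminus: "laurent_at_one (- a) = - laurent_at_one a"
  using laurent_at_one_diff[of 0 a] by simp

lemma laurent_at_one_add: "laurent_at_one (a + b) = laurent_at_one a + laurent_at_one b"
  using laurent_at_one_diff[of a "- b"] by (simp add: laurent_at_one_uminus)

section \<open>Symmetric units and uniqueness of the normalized generator\<close>

lemma lookup_mult_top:
  fixes p q :: "int \<Rightarrow>\<^sub>0 int"
  assumes "\<And>k. k \<in> Poly_Mapping.keys p \<Longrightarrow> k \<le> M" "\<And>k. k \<in> Poly_Mapping.keys q \<Longrightarrow> k \<le> N"
  shows "Poly_Mapping.lookup (p * q) (M + N) = Poly_Mapping.lookup p M * Poly_Mapping.lookup q N"
proof -
  \<comment> \<open>The terms at the bounds are split off. Every product involving a remainder has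
    its exponents strictly below \<open>M + N\<close>.\<close>
  define p0 q0 where "p0 = Poly_Mapping.single M (Poly_Mapping.lookup p M)"
    and "q0 = Poly_Mapping.single N (Poly_Mapping.lookup q N)"
  have p1: "k < M" if "k \<in> Poly_Mapping.keys (p - p0)" for k
    using that assms(1)[of k]
    by (cases "k = M") (auto simp: p0_def in_keys_iff lookup_minus lookup_single when_def)
  have q1: "k < N" if "k \<in> Poly_Mapping.keys (q - q0)" for k
    using that assms(2)[of k]
    by (cases "k = N") (auto simp: q0_def in_keys_iff lookup_minus lookup_single when_def)
  have p0: "k = M" if "k \<in> Poly_Mapping.keys p0" for k
    using that by (auto simp: p0_def split: if_splits)
  have "M + N \<notin> Poly_Mapping.keys (p0 * (q - q0))"
    using keys_mult[of p0 "q - q0"] q1 p0 by fastforce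
  moreover have "M + N \<notin> Poly_Mapping.keys ((p - p0) * q)"
    using keys_mult[of "p - p0" q] p1 assms(2) by fastforce
  moreover have "p * q = p0 * q0 + p0 * (q - q0) + (p - p0) * q"
    by (simp add: algebra_simps)
  ultimately have "Poly_Mapping.lookup (p * q) (M + N) = Poly_Mapping.lookup (p0 * q0) (M + N)"
    by (simp add: lookup_add in_keys_iff)
  then show ?thesis
    by (simp add: p0_def q0_def mult_single lookup_single)
qed

text \<open>Reflection makes the set of exponents closed under negation, so its maximum is at least
  its own negative.\<close>

lemma symmetric_Max_keys:
  assumes "laurent_reflect u = u" "u \<noteq> 0"
  shows "0 \<le> Max (Poly_Mapping.keys u)"
proof -
  have "Max (Poly_Mapping.keys u) \<in> Poly_Mapping.keys u"
    using assms(2) by (intro Max_in) simp_all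
  then have "- Max (Poly_Mapping.keys u) \<in> Poly_Mapping.keys u"
    using lookup_laurent_reflect[of u "Max (Poly_Mapping.keys u)"] assms(1)
    by (simp add: in_keys_iff)
  then have "- Max (Poly_Mapping.keys u) \<le> Max (Poly_Mapping.keys u)"
    by (intro Max_ge) simp_all
  then show ?thesis by simp
qed

lemma symmetric_constant:
  assumes "laurent_reflect u = u" "\<And>k. k \<in> Poly_Mapping.keys u \<Longrightarrow> k \<le> 0"
  shows "u = Poly_Mapping.single 0 (Poly_Mapping.lookup u 0)"
proof (rule poly_mapping_eqI)
  fix k
  have "k \<in> Poly_Mapping.keys u \<longleftrightarrow> - k \<in> Poly_Mapping.keys u"
    using lookup_laurent_reflect[of u k] assms(1) by (simp add: in_keys_iff)
  then have "k = 0" if "k \<in> Poly_Mapping.keys u"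
    using assms(2)[of k] assms(2)[of "- k"] that by simp
  then show "Poly_Mapping.lookup u k
      = Poly_Mapping.lookup (Poly_Mapping.single 0 (Poly_Mapping.lookup u 0)) k"
    by (auto simp: lookup_single when_def in_keys_iff)
qed

lemma symmetric_unit:
  assumes "laurent_reflect u = u" "laurent_reflect v = v" "u * v = 1"
  shows "u = 1 \<or> u = - 1"
proof -
  define M N where "M = Max (Poly_Mapping.keys u)" and "N = Max (Poly_Mapping.keys v)"
  have nz: "u \<noteq> 0" "v \<noteq> 0" using assms(3) by auto
  have ge: "0 \<le> M" "0 \<le> N"
    unfolding M_def N_def using assms nz by (simp_all add: symmetric_Max_keys)
  have top: "Poly_Mapping.lookup (u * v) (M + N) = Poly_Mapping.lookup u M * Poly_Mapping.lookup v N"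
    by (rule lookup_mult_top) (simp_all add: M_def N_def)
  have "M \<in> Poly_Mapping.keys u" "N \<in> Poly_Mapping.keys v"
    unfolding M_def N_def using nz by (simp_all add: Max_in)
  \<comment> \<open>The integers have no zero divisors, so the leading coefficients multiply to a
    nonzero one; the only exponent of \<open>1\<close> is \<open>0\<close>.\<close>
  then have "Poly_Mapping.lookup (u * v) (M + N) \<noteq> 0"
    using top by (simp add: in_keys_iff)
  then have "M + N = 0"
    using assms(3) by (simp add: lookup_one when_def split: if_splits)
  then have MN: "M = 0" "N = 0" using ge by simp_all
  have "Poly_Mapping.lookup u 0 * Poly_Mapping.lookup v 0 = 1"
    using top assms(3) by (simp add: MN)
  then have "Poly_Mapping.lookup u 0 = 1 \<or> Poly_Mapping.lookup u 0 = - 1"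
    by (simp add: zmult_eq_1_iff) auto
  moreover have "u = Poly_Mapping.single 0 (Poly_Mapping.lookup u 0)"
    using assms(1) MN(1) by (intro symmetric_constant) (metis Max_ge M_def finite_keys)+
  ultimately show ?thesis
    by (metis single_one single_uminus)
qed

lemma module_mult: "module ((*) :: 'a :: comm_ring_1 \<Rightarrow> 'a \<Rightarrow> 'a)"
  by standard (simp_all add: algebra_simps)

text \<open>The generators are multiples of each other. Cancelling in the reflected equations makes
  the multipliers symmetric, and they are mutually inverse; the value at \<open>1\<close> then rules
  out the sign \<open>- 1\<close>.\<close>

lemma symmetric_generator_unique:
  assumes span: "module.span (*) {a} = module.span (*) {b}"
    and refl: "laurent_reflect a = a" "laurent_reflect b = b"
    and one: "laurent_at_one a = 1" "laurent_at_one b = 1"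
  shows "a = b"
proof -
  have nz: "a \<noteq> 0" "b \<noteq> 0" using one by auto
  have "a \<in> range (\<lambda>k. k * b)" "b \<in> range (\<lambda>k. k * a)"
    using span module.span_base[OF module_mult, of a "{a}"]
      module.span_base[OF module_mult, of b "{b}"]
    by (simp_all add: module.span_singleton[OF module_mult])
  then obtain u v where u: "a = u * b" and v: "b = v * a" by blast
  have "laurent_reflect u * b = u * b"
    using refl by (metis u laurent_reflect_mult)
  then have "laurent_reflect u = u" using nz by simp
  moreover have "laurent_reflect v * a = v * a"
    using refl by (metis v laurent_reflect_mult)
  then have "laurent_reflect v = v" using nz by simp
  moreover have "(u * v) * a = 1 * a"
    by (metis u v mult.assoc mult_1)
  then have "u * v = 1" using nz by (metis mult_right_cancel)
  ultimately have "u = 1 \<or> u = - 1" by (rule symmetric_unit)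
  then show ?thesis
    using u one by (auto simp: laurent_at_one_uminus)
qed

lemma alexander_polynomial_eqI:
  assumes "module.span (*) {d} = elementary_ideal r" "laurent_reflect d = d" "laurent_at_one d = 1"
  shows "alexander_polynomial r = d"
  unfolding alexander_polynomial_def
proof (rule the_equality)
  fix d'
  assume "module.span (*) {d'} = elementary_ideal r \<and> laurent_reflect d' = d' \<and> laurent_at_one d' = 1"
  then show "d' = d"
    using assms by (metis symmetric_generator_unique)
qed (use assms in simp)

section \<open>Abelianized Fox derivatives\<close>

definition abel_fox :: "'a \<Rightarrow> 'a free_group \<Rightarrow> (int \<Rightarrow>\<^sub>0 int)" where
  "abel_fox j g = group_ring_map exponent_sum (fox j g)"

lemma exponent_sum_0 [simp]: "exponent_sum 0 = 0"
  using exponent_sum_add[of 0 0] by simp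

lemma exponent_sum_uminus: "exponent_sum (- g) = - exponent_sum g"
  using exponent_sum_add[of "- g" g] by simp

lemma abel_fox_add:
  "abel_fox j (g + h) = abel_fox j g + frag_of (exponent_sum g) * abel_fox j h"
  by (simp add: abel_fox_def fox_add group_ring_map_add group_ring_map_mult exponent_sum_add)

lemma abel_fox_0 [simp]: "abel_fox j 0 = 0"
  using abel_fox_add[of j 0 0] by (simp add: frag_of_zero)

lemma abel_fox_gen: "abel_fox j (gen i) = (if i = j then 1 else 0)"
  by (simp add: abel_fox_def fox_gen flip: single_one)

lemma abel_fox_uminus: "abel_fox j (- g) = - (frag_of (- exponent_sum g) * abel_fox j g)"
  using abel_fox_add[of j "- g" g] by (simp add: exponent_sum_uminus eq_neg_iff_add_eq_0)

lemma exponent_sum_diff: "exponent_sum (g - h) = exponent_sum g - exponent_sum h"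
  using exponent_sum_add[of g "- h"] by (simp add: exponent_sum_uminus)

lemma abel_fox_diff:
  "abel_fox j (g - h) = abel_fox j g - frag_of (exponent_sum g - exponent_sum h) * abel_fox j h"
  using abel_fox_add[of j g "- h"]
  by (simp add: abel_fox_uminus flip: mult.assoc frag_of_add)

lemma frag_of_uminus_mult: "frag_of (- k) * (frag_of k * x) = x" "frag_of k * (frag_of (- k) * x) = x"
  for x :: "int \<Rightarrow>\<^sub>0 int"
  by (simp_all add: frag_of_zero flip: frag_of_add mult.assoc)

lemma frag_of_one_neq: "frag_of 1 - (1 :: int \<Rightarrow>\<^sub>0 int) \<noteq> 0"
proof
  assume "frag_of 1 - (1 :: int \<Rightarrow>\<^sub>0 int) = 0"
  then have "Poly_Mapping.lookup (frag_of (1 :: int)) 0 = Poly_Mapping.lookup (1 :: int \<Rightarrow>\<^sub>0 int) 0"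
    by (simp only: right_minus_eq)
  then show False by (simp add: lookup_single lookup_one)
qed

text \<open>Abelianized form of Fox's fundamental formula: both generators map to \<open>t\<close>,
  so the factor \<open>t - 1\<close> comes out of the sum. It yields one derivative of the relator
  from the other.\<close>

lemma fox_fundamental_formula:
  "(frag_of 1 - 1) * (abel_fox GenX g + abel_fox GenY g) = frag_of (exponent_sum g) - 1"
proof (induction g rule: free_group_induct)
  case zero
  show ?case by (simp add: frag_of_zero)
next
  case (gen i g)
  have "abel_fox GenX (gen i + g) + abel_fox GenY (gen i + g)
      = 1 + frag_of 1 * (abel_fox GenX g + abel_fox GenY g)"
    by (cases i) (simp_all add: abel_fox_add abel_fox_gen exponent_sum_gen algebra_simps)
  then have "(frag_of 1 - 1) * (abel_fox GenX (gen i + g) + abel_fox GenY (gen i + g))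
      = frag_of 1 - 1 + frag_of 1 * ((frag_of 1 - 1) * (abel_fox GenX g + abel_fox GenY g))"
    by (simp only: distrib_left mult_1_right mult.left_commute)
  then show ?case
    by (simp only: gen.IH exponent_sum_add exponent_sum_gen frag_of_add) (simp add: right_diff_distrib)
next
  case (uminus_gen i g)
  have "abel_fox GenX (- gen i + g) + abel_fox GenY (- gen i + g)
      = frag_of (- 1) * (abel_fox GenX g + abel_fox GenY g) - frag_of (- 1)"
    by (cases i)
       (simp_all add: abel_fox_add abel_fox_gen abel_fox_uminus exponent_sum_gen exponent_sum_uminus
          algebra_simps)
  then have "(frag_of 1 - 1) * (abel_fox GenX (- gen i + g) + abel_fox GenY (- gen i + g))
      = frag_of (- 1) * ((frag_of 1 - 1) * (abel_fox GenX g + abel_fox GenY g))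
        - (frag_of 1 * (frag_of (- 1) * 1) - frag_of (- 1))"
    by (simp only: right_diff_distrib left_diff_distrib mult_1_right mult_1_left mult.left_commute)
  then show ?case
    by (simp only: uminus_gen.IH exponent_sum_add exponent_sum_gen exponent_sum_uminus frag_of_add
          frag_of_uminus_mult) (simp add: right_diff_distrib)
qed

section \<open>Kmot words\<close>

text \<open>Horner form of the sum of \<open>(-1)^i t^(p_i)\<close>, where \<open>p_0 = 0\<close>
  and \<open>p_i\<close> is the sum of the first \<open>i\<close> entries.\<close>

fun alternating_sum :: "int list \<Rightarrow> (int \<Rightarrow>\<^sub>0 int)" where
  "alternating_sum [] = 1"
| "alternating_sum (a # es) = 1 - frag_of a * alternating_sum es"

lemma alternating_sum_snoc:
  "alternating_sum (es @ [a]) = alternating_sum es - (- 1) ^ length es * frag_of (sum_list es + a)"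
proof (induction es)
  case (Cons b es)
  have "frag_of b * ((- 1) ^ length es * frag_of (sum_list es + a))
      = (- 1) ^ length es * frag_of (sum_list (b # es) + a)"
    by (simp add: add.assoc frag_of_add mult.left_commute)
  with Cons.IH show ?case
    by (simp add: right_diff_distrib)
qed simp

lemma kmot_word_snoc:
  "kmot_word (es @ [a]) =
     kmot_word es + sign_power (gen (if even (length es) then GenX else GenY)) a"
proof -
  have "map (\<lambda>i. sign_power (gen (if even i then GenX else GenY)) ((es @ [a]) ! i)) [0..<length es]
      = map (\<lambda>i. sign_power (gen (if even i then GenX else GenY)) (es ! i)) [0..<length es]"
    by (intro map_cong) (auto simp: nth_append)
  then show ?thesis by (simp add: kmot_word_def del: map_eq_conv)
qed

lemma exponent_sum_kmot_word:
  assumes "set es \<subseteq> {1, - 1}"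
  shows "exponent_sum (kmot_word es) = sum_list es"
  using assms
proof (induction es rule: rev_induct)
  case Nil
  show ?case by (simp add: kmot_word_def)
next
  case (snoc a es)
  then show ?case
    by (auto simp: kmot_word_snoc exponent_sum_add sign_power_def exponent_sum_uminus exponent_sum_gen)
qed

text \<open>For \<open>s = - 1\<close> the derivative is \<open>- t^(-1)\<close> if
  \<open>i = j\<close>, and \<open>(t - 1) * (- t^(-1)) = t^(-1) - 1\<close>; thus both signs give
  one formula.\<close>

lemma abel_fox_sign_power:
  assumes "s = 1 \<or> s = - 1"
  shows "(frag_of 1 - 1) * abel_fox j (sign_power (gen i) s) = (if i = j then frag_of s - 1 else 0)"
proof -
  have "frag_of 1 * frag_of (- 1) = (1 :: int \<Rightarrow>\<^sub>0 int)"
    by (simp add: frag_of_zero flip: frag_of_add)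
  then show ?thesis
    using assms
    by (auto simp: sign_power_def abel_fox_gen abel_fox_uminus exponent_sum_gen left_diff_distrib)
qed

text \<open>Odd lengths are included so that the induction can append single letters. There the word
  ends in a power of \<open>x\<close>, and the extra summand removes the last term of the
  alternating sum, which no power of \<open>y\<close> has matched yet.\<close>

lemma abel_fox_kmot_word:
  assumes "set es \<subseteq> {1, - 1}"
  shows "1 + (frag_of 1 - 1) * abel_fox GenY (kmot_word es) =
    alternating_sum es + (if even (length es) then 0 else frag_of (sum_list es))"
  using assms
proof (induction es rule: rev_induct)
  case Nil
  show ?case by (simp add: kmot_word_def)
next
  case (snoc a es)
  define i where "i = (if even (length es) then GenX else GenY)"
  have es: "set es \<subseteq> {1, - 1}" and a: "a = 1 \<or> a = - 1" using snoc.prems by auto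
  have "1 + (frag_of 1 - 1) * abel_fox GenY (kmot_word (es @ [a]))
      = (1 + (frag_of 1 - 1) * abel_fox GenY (kmot_word es))
        + frag_of (sum_list es) * ((frag_of 1 - 1) * abel_fox GenY (sign_power (gen i) a))"
    by (simp add: kmot_word_snoc abel_fox_add exponent_sum_kmot_word[OF es] algebra_simps flip: i_def)
  also have "\<dots> = alternating_sum es + (if even (length es) then 0 else frag_of (sum_list es))
        + frag_of (sum_list es) * (if i = GenY then frag_of a - 1 else 0)"
    by (simp only: snoc.IH[OF es] abel_fox_sign_power[OF a])
  also have "\<dots> = alternating_sum (es @ [a])
        + (if even (length (es @ [a])) then 0 else frag_of (sum_list (es @ [a])))"
    by (simp add: i_def alternating_sum_snoc right_diff_distrib flip: frag_of_add)
  finally show ?case .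
qed

text \<open>The two derivatives are \<open>D\<close> and \<open>- D\<close>. The unit
  \<open>t^k\<close> is left free so that the generator can be centred later.\<close>

lemma elementary_ideal_kmot_relator:
  assumes "set es \<subseteq> {1, - 1}" "even (length es)"
  shows "elementary_ideal (kmot_relator es) = module.span (*) {frag_of k * alternating_sum es}"
proof -
  interpret module "(*) :: (int \<Rightarrow>\<^sub>0 int) \<Rightarrow> _" by (rule module_mult)
  define w where "w = kmot_word es"
  define D where "D = alternating_sum es"
  have "abel_fox GenY (kmot_relator es) = - (1 + (frag_of 1 - 1) * abel_fox GenY w)"
    by (simp add: kmot_relator_def abel_fox_diff abel_fox_add abel_fox_gen exponent_sum_diff
          exponent_sum_add exponent_sum_gen left_diff_distrib frag_of_zero flip: w_def)
  then have Y: "abel_fox GenY (kmot_relator es) = - D"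
    using abel_fox_kmot_word[OF assms(1)] assms(2) by (simp add: w_def D_def)
  have "exponent_sum (kmot_relator es) = 0"
    by (simp add: kmot_relator_def exponent_sum_add exponent_sum_diff exponent_sum_gen)
  \<comment> \<open>The relator has exponent sum \<open>0\<close>, so the fundamental formula makes
    the derivatives opposite once \<open>t - 1\<close> is cancelled.\<close>
  then have "(frag_of 1 - 1) * (abel_fox GenX (kmot_relator es) + abel_fox GenY (kmot_relator es)) = 0"
    by (simp only: fox_fundamental_formula) (simp add: frag_of_zero)
  then have "abel_fox GenX (kmot_relator es) + abel_fox GenY (kmot_relator es) = 0"
    using frag_of_one_neq by (simp only: mult_eq_0_iff) blast
  then have X: "abel_fox GenX (kmot_relator es) = D"
    by (simp add: Y)
  have "elementary_ideal (kmot_relator es) = span {D, - D}"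
    by (simp add: elementary_ideal_def X Y flip: abel_fox_def)
  also have "\<dots> = span {frag_of k * D}"
  proof (subst span_eq, intro conjI)
    have "D = frag_of (- k) * (frag_of k * D)" by (simp only: frag_of_uminus_mult)
    then have "D \<in> span {frag_of k * D}"
      by (metis span_scale span_base singletonI)
    then show "{D, - D} \<subseteq> span {frag_of k * D}"
      by (simp add: span_neg)
    show "{frag_of k * D} \<subseteq> span {D, - D}"
      by (simp add: span_base span_scale)
  qed
  finally show ?thesis by (simp add: D_def)
qed

section \<open>The Alexander polynomials of palindromes\<close>

text \<open>With \<open>t = exp u\<close> this is \<open>2 cosh (k u)\<close>, which explains the
  product formula below.\<close>

definition laurent_cosh :: "int \<Rightarrow> (int \<Rightarrow>\<^sub>0 int)" where
  "laurent_cosh k = frag_of k + frag_of (- k)"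

fun centred_polynomial :: "(nat \<Rightarrow> int) \<Rightarrow> nat \<Rightarrow> (int \<Rightarrow>\<^sub>0 int)" where
  "centred_polynomial e 0 = 1"
| "centred_polynomial e (Suc n) = laurent_cosh (\<Sum>i=1..Suc n. e i) - centred_polynomial e n"

lemma palindrome_Suc: "palindrome e (Suc n) = e (Suc n) # palindrome e n @ [e (Suc n)]"
  by (simp add: palindrome_def)

lemma length_palindrome: "length (palindrome e n) = 2 * n"
  by (simp add: palindrome_def)

lemma sum_list_palindrome: "sum_list (palindrome e n) = 2 * (\<Sum>i=1..n. e i)"
  by (induction n) (simp_all add: palindrome_Suc, simp add: palindrome_def)

text \<open>The middle partial sum of the palindrome is \<open>q = e 1 + ... + e n\<close>, and the
  shift by \<open>- q\<close> moves it to exponent \<open>0\<close>. Each added outer pair of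
  letters contributes the two new extreme terms and reverses the sign of the rest.\<close>

lemma centred_polynomial_eq:
  "centred_polynomial e n = frag_of (- (\<Sum>i=1..n. e i)) * alternating_sum (palindrome e n)"
proof (induction n)
  case 0
  show ?case by (simp add: palindrome_def frag_of_zero)
next
  case (Suc n)
  define q a where "q = (\<Sum>i=1..n. e i)" and "a = e (Suc n)"
  \<comment> \<open>The inner palindrome has even length and total \<open>2 * q\<close>, which fixes
    the sign and the exponent of the last term.\<close>
  have "alternating_sum (palindrome e (Suc n))
      = 1 - frag_of a * (alternating_sum (palindrome e n) - frag_of (2 * q + a))"
    by (simp add: palindrome_Suc alternating_sum_snoc length_palindrome sum_list_palindrome q_def a_def)
  then have "frag_of (- (q + a)) * alternating_sum (palindrome e (Suc n))
      = frag_of (- (q + a)) + frag_of (- (q + a)) * (frag_of a * frag_of (2 * q + a))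
        - (frag_of (- (q + a)) * frag_of a) * alternating_sum (palindrome e n)"
    by (simp only: right_diff_distrib mult_1_right mult.assoc) simp
  also have "\<dots> = laurent_cosh (q + a) - frag_of (- q) * alternating_sum (palindrome e n)"
    by (simp add: laurent_cosh_def add.commute flip: frag_of_add)
  finally show ?case
    using Suc.IH by (simp add: q_def a_def)
qed

lemma laurent_reflect_centred_polynomial:
  "laurent_reflect (centred_polynomial e n) = centred_polynomial e n"
proof (induction n)
  case 0
  show ?case by (simp add: laurent_reflect_def flip: single_one)
next
  case (Suc n)
  then show ?case
    by (simp add: laurent_reflect_def group_ring_map_diff group_ring_map_add laurent_cosh_def add.commute)
qed

lemma laurent_at_one_centred_polynomial: "laurent_at_one (centred_polynomial e n) = 1"
proof (induction n)
  case 0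
  show ?case by (simp flip: single_one)
next
  case (Suc n)
  then show ?case
    by (simp add: laurent_at_one_diff laurent_at_one_add laurent_cosh_def)
qed

lemma kmot_alexander_eq:
  assumes "\<And>i. i \<ge> 1 \<Longrightarrow> e i \<in> {- 1, 1}"
  shows "kmot_alexander e n = centred_polynomial e n"
proof (cases "n = 0")
  case False
  have "set (palindrome e n) \<subseteq> {1, - 1}"
    using symmetric_sign_sequence_palindrome[of e n] assms by (simp add: symmetric_sign_sequence_def)
  then have "alexander_polynomial (kmot_relator (palindrome e n)) = centred_polynomial e n"
    \<comment> \<open>The free exponent is chosen as the centring shift.\<close>
    using elementary_ideal_kmot_relator[of "palindrome e n" "- (\<Sum>i=1..n. e i)"]
    by (intro alexander_polynomial_eqI laurent_reflect_centred_polynomial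
          laurent_at_one_centred_polynomial)
       (simp add: length_palindrome centred_polynomial_eq)
  with False show ?thesis by (simp add: kmot_alexander_def)
qed (simp add: kmot_alexander_def)

section \<open>The recurrence\<close>

lemma laurent_cosh_mult:
  "laurent_cosh j * laurent_cosh k = laurent_cosh (k + j) + laurent_cosh (k - j)"
  by (simp add: laurent_cosh_def distrib_left distrib_right add.commute flip: frag_of_add)

theorem corollary6p7:
  fixes e \<delta> :: "nat \<Rightarrow> int" and \<alpha> \<Delta> :: "nat \<Rightarrow> (int \<Rightarrow>\<^sub>0 int)" and n :: nat
  assumes "\<And>i. i \<ge> 1 \<Longrightarrow> e i \<in> {- 1, 1}"
    and "\<And>k. \<Delta> k = kmot_alexander e k"
    and "\<And>k. k \<ge> 2 \<Longrightarrow> \<delta> k = e (k - 1) * e k"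
    and "\<And>k. k \<ge> 2 \<Longrightarrow> \<alpha> k = of_int ((\<delta> k + 1) div 2) * (frag_of 1 + frag_of (- 1))"
    and "n > 2"
  shows "\<Delta> n + \<Delta> (n - 1) =
    \<alpha> n * (\<Delta> (n - 1) + \<Delta> (n - 2)) - of_int (\<delta> n) * (\<Delta> (n - 2) + \<Delta> (n - 3))"
proof -
  define q where "q m = (\<Sum>i=1..m. e i)" for m
  have \<Delta>: "\<Delta> m = centred_polynomial e m" for m
    by (simp only: assms(2) kmot_alexander_eq[of e, OF assms(1)])
  have cosh: "\<Delta> (Suc m) + \<Delta> m = laurent_cosh (q (Suc m))" for m
    by (simp only: \<Delta> q_def centred_polynomial.simps diff_add_cancel)
  \<comment> \<open>Writing \<open>n\<close> as \<open>m + 3\<close> keeps the subtraction in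
    \<open>n - 3\<close> from truncating.\<close>
  obtain m where n: "n = Suc (Suc (Suc m))"
    using less_imp_Suc_add[OF \<open>n > 2\<close>] by (auto simp: numeral_2_eq_2)
  define a b where "a = e (Suc (Suc m))" and "b = e n"
  have ab: "a = 1 \<or> a = - 1" "b = 1 \<or> b = - 1"
    using assms(1)[of "Suc (Suc m)"] assms(1)[of n] by (auto simp: a_def b_def n)
  have q: "q (Suc (Suc m)) = q (Suc m) + a" "q n = q (Suc m) + a + b"
    by (simp_all add: q_def a_def b_def n)
  have \<delta>: "\<delta> n = a * b" using assms(3)[of n] by (simp add: a_def b_def n)
  have \<alpha>: "\<alpha> n = of_int ((a * b + 1) div 2) * laurent_cosh 1"
    using assms(4)[of n] \<delta> by (simp add: n laurent_cosh_def)
  \<comment> \<open>The four sign cases. The division by \<open>2\<close> is exact: if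
    \<open>a = b\<close>, the product formula gives the terms at \<open>q n\<close> and
    \<open>q (Suc m)\<close>, and the latter cancels; otherwise \<open>\<alpha> n = 0\<close> and
    \<open>q n = q (Suc m)\<close>.\<close>
  have "laurent_cosh (q n) = \<alpha> n * laurent_cosh (q (Suc (Suc m))) - of_int (\<delta> n) * laurent_cosh (q (Suc m))"
    using ab by (auto simp: q \<alpha> \<delta> laurent_cosh_mult)
  moreover have "n - 1 = Suc (Suc m)" "n - 2 = Suc m" "n - 3 = m"
    by (simp_all add: n)
  ultimately show ?thesis
    using cosh[of m] cosh[of "Suc m"] cosh[of "Suc (Suc m)"] by (simp only: n)
qed

end
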